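(* Let $G$ be a strictly unimodal uniform grid with associated integer $N$. For every $d\in[0,N]$ and every $E\subseteq[0,N]$, $$\mathrm{Z^*cl}_{G,d}(E)=\overline{L}_{N,d}(E).$$
   Context: For integers $a\le b$, $[a,b]$ denotes the set of integers $t$ with $a\le t\le b$ (and $[a,b]=\emptyset$ if $a>b$); $[n]=[1,n]$. A uniform grid is a set $G=[0,k_1-1]\times\cdots\times[0,k_n-1]\subseteq\mathbb{R}^n$ with $n\ge1$ and integers $k_i\ge2$; put $N=\sum_{i\in[n]}(k_i-1)$. The weight of $x\in G$ is $\mathrm{wt}(x)=\sum_{i\in[n]}x_i$. For $E\subseteq[0,N]$ let $\underline{E}=\{x\in G:\mathrm{wt}(x)\in E\}$, and $\underline{j}=\underline{\{j\}}$. The grid $G$ is strictly unimodal if $|\underline{0}|<|\underline{1}|<\cdots<|\underline{\lfloor N/2\rfloor}|=|\underline{\lceil N/2\rceil}|>\cdots>|\underline{N}|$. For $d\in[0,N]$ and $S\subseteq G$, $\mathrm{Zcl}_{G,d}(S)$ is the set of all $a\in G$ such that $P(a)=0$ for every $P\in\mathbb{R}[X_1,\ldots,X_n]$ of degree at most $d$ (the zero polynomial included) that vanishes on $S$. For $E\subseteq[0,N]$, $\mathrm{Z^*cl}_{G,d}(E)=\{j\in[0,N]:\underline{j}\subseteq\mathrm{Zcl}_{G,d}(\underline{E})\}$. For $M\in\mathbb{Z}^+$, $d\in[0,M]$ and $E=\{t_1<\cdots<t_s\}\subseteq[0,M]$, define $L_{M,d}(E)=E$ if $|E|\le d$, and $L_{M,d}(E)=[0,t_{s-d}]\cup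 E\cup[t_{d+1},M]$ if $|E|\ge d+1$. With $L_{M,d}^0=\mathrm{id}$ and $L_{M,d}^{k+1}=L_{M,d}\circ L_{M,d}^k$, define $\overline{L}_{M,d}(E)=\bigcup_{k\ge0}L_{M,d}^k(E)$. *)

theory Defs
  imports Complex_Main "HOL-Library.Poly_Mapping" "HOL-Library.FuncSet"
begin

text \<open>
  The ring \<open>\<real>[X\<^sub>1, \<dots>, X\<^sub>n]\<close> is rendered by finitely supported maps from
  exponent vectors to coefficients, with all exponents outside \<open>{1..n}\<close> equal to zero.
\<close>

type_synonym real_mpoly = "(nat \<Rightarrow>\<^sub>0 nat) \<Rightarrow>\<^sub>0 real"

definition mpolys :: "nat \<Rightarrow> real_mpoly set" where
  "mpolys n = {P. \<forall>m \<in> Poly_Mapping.keys P. Poly_Mapping.keys m \<subseteq> {1..n}}"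

definition monom_degree :: "(nat \<Rightarrow>\<^sub>0 nat) \<Rightarrow> nat" where
  "monom_degree m = (\<Sum>i \<in> Poly_Mapping.keys m. Poly_Mapping.lookup m i)"

text \<open>The zero polynomial gets degree 0, so it has degree at most \<open>d\<close> for every \<open>d\<close>.\<close>

definition total_degree :: "real_mpoly \<Rightarrow> nat" where
  "total_degree P = Max (insert 0 (monom_degree ` Poly_Mapping.keys P))"

definition mpoly_eval :: "real_mpoly \<Rightarrow> (nat \<Rightarrow> real) \<Rightarrow> real" where
  "mpoly_eval P x = (\<Sum>m \<in> Poly_Mapping.keys P. Poly_Mapping.lookup P m *
      (\<Prod>i \<in> Poly_Mapping.keys m. x i ^ Poly_Mapping.lookup m i))"

text \<open>
  A point of \<open>[0, k\<^sub>1 - 1] \<times> \<dots> \<times> [0, k\<^sub>n - 1]\<close> is a function on the index set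
  \<open>{1..n}\<close> with natural-number coordinates, extended by \<open>undefined\<close> outside
  \<open>{1..n}\<close>, so that distinct functions are distinct points and layers can be counted by
  \<open>card\<close>.  Coordinates are cast to the reals when a polynomial is evaluated.
\<close>

definition grid :: "nat \<Rightarrow> (nat \<Rightarrow> nat) \<Rightarrow> (nat \<Rightarrow> nat) set" where
  "grid n k = (\<Pi>\<^sub>E i \<in> {1..n}. {0..k i - 1})"

definition uniform_grid :: "nat \<Rightarrow> (nat \<Rightarrow> nat) \<Rightarrow> bool" where
  "uniform_grid n k \<longleftrightarrow> n \<ge> 1 \<and> (\<forall>i \<in> {1..n}. k i \<ge> 2)"

definition grid_N :: "nat \<Rightarrow> (nat \<Rightarrow> nat) \<Rightarrow> nat" where
  "grid_N n k = (\<Sum>i \<in> {1..n}. (k i - 1))"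

definition wt :: "nat \<Rightarrow> (nat \<Rightarrow> nat) \<Rightarrow> nat" where
  "wt n x = (\<Sum>i \<in> {1..n}. x i)"

definition layers :: "nat \<Rightarrow> (nat \<Rightarrow> nat) \<Rightarrow> nat set \<Rightarrow> (nat \<Rightarrow> nat) set" where
  "layers n k E = {x \<in> grid n k. wt n x \<in> E}"

text \<open>Here \<open>N div 2\<close> and \<open>(N + 1) div 2\<close> are the floor and the ceiling of \<open>N / 2\<close>.\<close>

definition strictly_unimodal :: "nat \<Rightarrow> (nat \<Rightarrow> nat) \<Rightarrow> bool" where
  "strictly_unimodal n k \<longleftrightarrow>
     (let N = grid_N n k; c = (\<lambda>j. card (layers n k {j})) in
        (\<forall>j. j < N div 2 \<longrightarrow> c j < c (j + 1)) \<and>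
        c (N div 2) = c ((N + 1) div 2) \<and>
        (\<forall>j. (N + 1) div 2 \<le> j \<and> j < N \<longrightarrow> c j > c (j + 1)))"

definition Zcl :: "nat \<Rightarrow> (nat \<Rightarrow> nat) \<Rightarrow> nat \<Rightarrow> (nat \<Rightarrow> nat) set \<Rightarrow> (nat \<Rightarrow> nat) set" where
  "Zcl n k d S = {a \<in> grid n k. \<forall>P \<in> mpolys n.
     total_degree P \<le> d \<longrightarrow> (\<forall>x \<in> S. mpoly_eval P (\<lambda>i. real (x i)) = 0) \<longrightarrow>
     mpoly_eval P (\<lambda>i. real (a i)) = 0}"

definition Zstar_cl :: "nat \<Rightarrow> (nat \<Rightarrow> nat) \<Rightarrow> nat \<Rightarrow> nat set \<Rightarrow> nat set" where
  "Zstar_cl n k d E = {j \<in> {0..grid_N n k}. layers n k {j} \<subseteq> Zcl n k d (layers n k E)}"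

text \<open>
  For finite \<open>E\<close>, \<open>nth_elem E i\<close> is the element \<open>t\<^sub>i\<close> of
  \<open>E = {t\<^sub>1 < \<dots> < t\<^sub>s}\<close>, with indices starting from 1.
\<close>

definition nth_elem :: "nat set \<Rightarrow> nat \<Rightarrow> nat" where
  "nth_elem E i = sorted_list_of_set E ! (i - 1)"

definition L_op :: "nat \<Rightarrow> nat \<Rightarrow> nat set \<Rightarrow> nat set" where
  "L_op M d E =
     (if card E \<le> d then E
      else {0..nth_elem E (card E - d)} \<union> E \<union> {nth_elem E (d + 1)..M})"

definition L_bar :: "nat \<Rightarrow> nat \<Rightarrow> nat set \<Rightarrow> nat set" where
  "L_bar M d E = (\<Union>i. (L_op M d ^^ i) E)"

end

theory Submission
  imports Defs "HOL-Computational_Algebra.Polynomial"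
begin

text \<open>
  On a box \<open>[0, m\<^sub>1] \<times> \<dots> \<times> [0, m\<^sub>n]\<close> weight each point \<open>x\<close> by the product of the binomial
  coefficients of \<open>m\<^sub>i\<close> over \<open>x\<^sub>i\<close>.  The weighted average of a polynomial of degree at most
  \<open>d\<close> over layer \<open>j\<close> is a univariate polynomial in \<open>j\<close> of degree at most \<open>d\<close>.  Applied to
  the box of grid points above (below) a point \<open>a\<close>, in which \<open>a\<close> is an extreme layer by itself,
  this shows that zeros on \<open>d + 1\<close> layers above (below) \<open>a\<close> force a zero at \<open>a\<close>.  Hence
  the iterates of \<open>L\<close> stay inside the closure.

  Conversely, for \<open>r \<le> j \<le> N - r\<close> there is a polynomial of degree at most \<open>r\<close> that vanishes on
  all layers outside \<open>[r, N - r]\<close> but not on all of layer \<open>j\<close>: since layer \<open>r\<close> is strictly larger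
  than layer \<open>N - r + 1\<close>, some nonzero combination of the products of binomials in the \<open>x\<^sub>i\<close>
  over \<open>a\<^sub>i\<close> with \<open>a\<close> in layer \<open>r\<close> vanishes on layer \<open>N - r + 1\<close>, and propagation of
  zeros does the rest.  If \<open>F\<close> is \<open>L\<close>-closed and \<open>j \<notin> F\<close>, then some such \<open>r\<close> satisfies
  \<open>r + |F \<inter> [r, N - r]| \<le> d\<close>, and multiplying by \<open>wt - t\<close> for \<open>t \<in> F \<inter> [r, N - r]\<close>
  gives a polynomial separating layer \<open>j\<close> from \<open>F\<close>.
\<close>


section \<open>Polynomial functions\<close>

text \<open>The index \<open>d\<close> is only an upper bound on the degree. Multiplication by one
  coordinate is the sole way to raise it, so induction over these rules matches the recursion for
  averages over layers.\<close>

inductive polyfun :: "nat \<Rightarrow> nat \<Rightarrow> ((nat \<Rightarrow> real) \<Rightarrow> real) \<Rightarrow> bool" for n where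
  const: "polyfun n d (\<lambda>x. c)"
| add: "polyfun n d f \<Longrightarrow> polyfun n d g \<Longrightarrow> polyfun n d (\<lambda>x. f x + g x)"
| var: "i \<in> {1..n} \<Longrightarrow> polyfun n d f \<Longrightarrow> polyfun n (Suc d) (\<lambda>x. x i * f x)"

lemma polyfun_mono: "polyfun n d f \<Longrightarrow> d \<le> e \<Longrightarrow> polyfun n e f"
proof (induction arbitrary: e rule: polyfun.induct)
  case (var i d f)
  then obtain e' where "e = Suc e'" "d \<le> e'" by (cases e) auto
  with var show ?case by (auto intro: polyfun.var)
qed (auto intro: polyfun.intros)

text \<open>Grid points are \<open>undefined\<close> outside \<open>{1..n}\<close>, while shifted
  points \<open>x + a\<close> are not; this lets the two be exchanged under
  \<open>f\<close>.\<close>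

lemma polyfun_cong:
  "polyfun n d f \<Longrightarrow> (\<And>i. i \<in> {1..n} \<Longrightarrow> x i = y i) \<Longrightarrow> f x = f y"
  by (induction rule: polyfun.induct) auto

lemma polyfun_scale: "polyfun n d f \<Longrightarrow> polyfun n d (\<lambda>x. c * f x)"
proof (induction rule: polyfun.induct)
  case (var i d f)
  then have "polyfun n (Suc d) (\<lambda>x. x i * (c * f x))" by (intro polyfun.var)
  then show ?case by (simp add: mult.left_commute)
qed (auto intro: polyfun.intros simp: distrib_left)

lemma polyfun_mult:
  "polyfun n d f \<Longrightarrow> polyfun n e g \<Longrightarrow> polyfun n (d + e) (\<lambda>x. f x * g x)"
proof (induction rule: polyfun.induct)
  case (const d c)
  then show ?case by (intro polyfun_scale) (rule polyfun_mono, auto)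
next
  case (add d f h)
  then have "polyfun n (d + e) (\<lambda>x. f x * g x + h x * g x)" by (intro polyfun.add)
  then show ?case by (simp add: distrib_right)
next
  case (var i d f)
  then have "polyfun n (Suc (d + e)) (\<lambda>x. x i * (f x * g x))" by (intro polyfun.var)
  then show ?case by (simp add: mult.assoc)
qed

lemma polyfun_sum:
  "(\<And>a. a \<in> A \<Longrightarrow> polyfun n d (f a)) \<Longrightarrow> polyfun n d (\<lambda>x. \<Sum>a\<in>A. f a x)"
  by (induction A rule: infinite_finite_induct) (auto intro: polyfun.intros)

lemma polyfun_prod:
  "(\<And>a. a \<in> A \<Longrightarrow> polyfun n (d a) (f a)) \<Longrightarrow> polyfun n (\<Sum>a\<in>A. d a) (\<lambda>x. \<Prod>a\<in>A. f a x)"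
  by (induction A rule: infinite_finite_induct) (auto intro: polyfun.const polyfun_mult)

lemma polyfun_coord: "i \<in> {1..n} \<Longrightarrow> polyfun n 1 (\<lambda>x. x i)"
  using polyfun.var[OF _ polyfun.const[of n 0 1]] by simp

lemma polyfun_coord_minus: "i \<in> {1..n} \<Longrightarrow> polyfun n 1 (\<lambda>x. x i - c)"
  using polyfun.add[OF polyfun_coord polyfun.const[of n 1 "-c"]] by simp

lemma polyfun_power: "polyfun n d f \<Longrightarrow> polyfun n (k * d) (\<lambda>x. f x ^ k)"
  by (induction k) (auto intro: polyfun.const polyfun_mult)

lemma polyfun_gbinomial:
  assumes "i \<in> {1..n}"
  shows "polyfun n k (\<lambda>x. x i gchoose k)"
proof -
  have "polyfun n (\<Sum>j\<in>{0..<k}. 1) (\<lambda>x. \<Prod>j\<in>{0..<k}. x i - of_nat j)"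
    using assms by (intro polyfun_prod polyfun_coord_minus)
  from polyfun_scale[OF this, of "inverse (fact k)"] show ?thesis
    by (simp add: gbinomial_prod_rev divide_inverse mult.commute)
qed

lemma polyfun_layer_prod:
  "polyfun n (card T) (\<lambda>x. \<Prod>t\<in>T. (\<Sum>i\<in>{1..n}. x i) - real t)"
proof -
  have "polyfun n 1 (\<lambda>x. (\<Sum>i\<in>{1..n}. x i) - real t)" for t
  proof -
    have "polyfun n 1 (\<lambda>x. (\<Sum>i\<in>{1..n}. x i) + - real t)"
      by (intro polyfun.add polyfun.const polyfun_sum polyfun_coord)
    then show ?thesis by simp
  qed
  then have "polyfun n (\<Sum>t\<in>T. 1) (\<lambda>x. \<Prod>t\<in>T. (\<Sum>i\<in>{1..n}. x i) - real t)"
    by (intro polyfun_prod)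
  then show ?thesis by simp
qed

section \<open>Passage between polynomial functions and formal polynomials\<close>

definition bounded_mpoly :: "nat \<Rightarrow> nat \<Rightarrow> real_mpoly \<Rightarrow> bool" where
  "bounded_mpoly n d P \<longleftrightarrow> P \<in> mpolys n \<and> total_degree P \<le> d"

lemma bounded_mpoly_iff:
  "bounded_mpoly n d P \<longleftrightarrow>
     (\<forall>m \<in> Poly_Mapping.keys P. Poly_Mapping.keys m \<subseteq> {1..n} \<and> monom_degree m \<le> d)"
  by (auto simp: bounded_mpoly_def mpolys_def total_degree_def)

text \<open>Extra exponent vectors carry coefficient 0, so polynomials with different supports can
  be evaluated over one common index set.\<close>

lemma mpoly_eval_superset:
  assumes "finite A" "Poly_Mapping.keys P \<subseteq> A"
  shows "mpoly_eval P x = (\<Sum>m\<in>A. Poly_Mapping.lookup P m *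
           (\<Prod>i \<in> Poly_Mapping.keys m. x i ^ Poly_Mapping.lookup m i))"
  unfolding mpoly_eval_def using assms
  by (intro sum.mono_neutral_left) (auto simp: in_keys_iff)

lemma mpoly_eval_add: "mpoly_eval (P + Q) x = mpoly_eval P x + mpoly_eval Q x"
proof -
  let ?A = "Poly_Mapping.keys P \<union> Poly_Mapping.keys Q"
  have "Poly_Mapping.keys (P + Q) \<subseteq> ?A" by (rule Poly_Mapping.keys_add)
  then show ?thesis
    by (subst (1 2 3) mpoly_eval_superset[of ?A])
       (auto simp: lookup_add distrib_right sum.distrib)
qed

lemma mpoly_eval_single:
  "mpoly_eval (Poly_Mapping.single m c) x =
     c * (\<Prod>i \<in> Poly_Mapping.keys m. x i ^ Poly_Mapping.lookup m i)"
  by (simp add: mpoly_eval_def)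

lemma mpoly_eval_sum: "mpoly_eval (\<Sum>a\<in>A. P a) x = (\<Sum>a\<in>A. mpoly_eval (P a) x)"
  by (induction A rule: infinite_finite_induct) (auto simp: mpoly_eval_add, auto simp: mpoly_eval_def)

lemma bounded_mpoly_add: "bounded_mpoly n d P \<Longrightarrow> bounded_mpoly n d Q \<Longrightarrow> bounded_mpoly n d (P + Q)"
  using Poly_Mapping.keys_add[of P Q] by (fastforce simp: bounded_mpoly_iff)

lemma bounded_mpoly_sum:
  "(\<And>a. a \<in> A \<Longrightarrow> bounded_mpoly n d (P a)) \<Longrightarrow> bounded_mpoly n d (\<Sum>a\<in>A. P a)"
  by (induction A rule: infinite_finite_induct)
     (auto intro: bounded_mpoly_add, auto simp: bounded_mpoly_iff)

lemma prod_keys_superset: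
  assumes "finite A" "Poly_Mapping.keys m \<subseteq> A"
  shows "(\<Prod>i \<in> Poly_Mapping.keys m. (x i :: real) ^ Poly_Mapping.lookup m i) =
         (\<Prod>i \<in> A. x i ^ Poly_Mapping.lookup m i)"
  using assms by (intro prod.mono_neutral_left) (auto simp: in_keys_iff)

lemma monom_degree_superset:
  assumes "finite A" "Poly_Mapping.keys m \<subseteq> A"
  shows "monom_degree m = (\<Sum>i \<in> A. Poly_Mapping.lookup m i)"
  unfolding monom_degree_def using assms by (intro sum.mono_neutral_left) (auto simp: in_keys_iff)

lemma polyfun_mpoly_eval:
  assumes "bounded_mpoly n d P"
  shows "polyfun n d (mpoly_eval P)"
proof -
  have "polyfun n d (\<lambda>x. Poly_Mapping.lookup P m *
           (\<Prod>i \<in> Poly_Mapping.keys m. x i ^ Poly_Mapping.lookup m i))"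
    if m: "m \<in> Poly_Mapping.keys P" for m
  proof -
    from m assms have *: "Poly_Mapping.keys m \<subseteq> {1..n}" "monom_degree m \<le> d"
      by (auto simp: bounded_mpoly_iff)
    have "polyfun n (\<Sum>i\<in>Poly_Mapping.keys m. Poly_Mapping.lookup m i * 1)
            (\<lambda>x. \<Prod>i \<in> Poly_Mapping.keys m. x i ^ Poly_Mapping.lookup m i)"
      using * by (intro polyfun_prod polyfun_power polyfun_coord) auto
    with * show ?thesis
      by (intro polyfun_scale) (rule polyfun_mono, auto simp: monom_degree_def)
  qed
  then have "polyfun n d (\<lambda>x. mpoly_eval P x)"
    unfolding mpoly_eval_def by (intro polyfun_sum)
  then show ?thesis .
qed

lemma monomial_times_var:
  fixes m :: "nat \<Rightarrow>\<^sub>0 nat" and x :: "nat \<Rightarrow> real"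
  assumes i: "i \<in> {1..n}" and m: "Poly_Mapping.keys m \<subseteq> {1..n}"
  defines "m' \<equiv> Poly_Mapping.single i 1 + m"
  shows "Poly_Mapping.keys m' \<subseteq> {1..n}"
    and "monom_degree m' = Suc (monom_degree m)"
    and "(\<Prod>j \<in> Poly_Mapping.keys m'. x j ^ Poly_Mapping.lookup m' j) =
         x i * (\<Prod>j \<in> Poly_Mapping.keys m. x j ^ Poly_Mapping.lookup m j)"
proof -
  show k: "Poly_Mapping.keys m' \<subseteq> {1..n}"
    using Poly_Mapping.keys_add[of "Poly_Mapping.single i 1" m] i m unfolding m'_def by auto
  have l: "Poly_Mapping.lookup m' j = (if j = i then 1 else 0) + Poly_Mapping.lookup m j" for j
    by (auto simp: m'_def lookup_add lookup_single)
  show "monom_degree m' = Suc (monom_degree m)"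
    using i by (simp add: monom_degree_superset[OF _ k] monom_degree_superset[OF _ m] l sum.distrib)
  have "(\<Prod>j\<in>{1..n}. x j ^ (if j = i then 1 else 0)) = x i"
    using i by (simp add: if_distrib[of "\<lambda>e. _ ^ e"] cong: if_cong)
  then show "(\<Prod>j \<in> Poly_Mapping.keys m'. x j ^ Poly_Mapping.lookup m' j) =
         x i * (\<Prod>j \<in> Poly_Mapping.keys m. x j ^ Poly_Mapping.lookup m j)"
    unfolding prod_keys_superset[OF finite_atLeastAtMost k]
      prod_keys_superset[OF finite_atLeastAtMost m]
    unfolding l power_add prod.distrib by simp
qed

text \<open>Separating functions are built as \<open>polyfun\<close>s, whereas \<open>Zcl\<close>
  quantifies over formal polynomials. The only substantial case is multiplication by a coordinate,
  which shifts every exponent vector.\<close>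

lemma polyfun_imp_mpoly_eval:
  "polyfun n d f \<Longrightarrow> \<exists>P. bounded_mpoly n d P \<and> mpoly_eval P = f"
proof (induction rule: polyfun.induct)
  case (const d c)
  have "bounded_mpoly n d (Poly_Mapping.single 0 c)"
    by (auto simp: bounded_mpoly_iff monom_degree_def)
  moreover have "mpoly_eval (Poly_Mapping.single 0 c) = (\<lambda>x. c)"
    by (simp add: mpoly_eval_single fun_eq_iff)
  ultimately show ?case by blast
next
  case (add d f g)
  then obtain P Q where "bounded_mpoly n d P" "mpoly_eval P = f"
    "bounded_mpoly n d Q" "mpoly_eval Q = g" by blast
  then show ?case by (intro exI[of _ "P + Q"]) (auto simp: mpoly_eval_add bounded_mpoly_add)
next
  case (var i d f)
  then obtain P where P: "bounded_mpoly n d P" "mpoly_eval P = f" by blast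
  define Q where "Q = (\<Sum>m\<in>Poly_Mapping.keys P.
    Poly_Mapping.single (Poly_Mapping.single i 1 + m) (Poly_Mapping.lookup P m))"
  have "bounded_mpoly n (Suc d) Q"
    unfolding Q_def using P(1) monomial_times_var(1,2)[OF \<open>i \<in> {1..n}\<close>]
    by (intro bounded_mpoly_sum) (auto simp: bounded_mpoly_iff split: if_splits)
  moreover have "mpoly_eval Q x = x i * f x" for x
  proof -
    have "mpoly_eval Q x = (\<Sum>m\<in>Poly_Mapping.keys P. Poly_Mapping.lookup P m *
        (x i * (\<Prod>j \<in> Poly_Mapping.keys m. x j ^ Poly_Mapping.lookup m j)))"
      unfolding Q_def mpoly_eval_sum mpoly_eval_single
      using P(1) by (intro sum.cong refl arg_cong2[of _ _ _ _ times] monomial_times_var(3)[OF \<open>i \<in> {1..n}\<close>])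
        (auto simp: bounded_mpoly_iff)
    also have "\<dots> = x i * mpoly_eval P x"
      by (simp add: mpoly_eval_def sum_distrib_left mult.left_commute)
    finally show ?thesis using P by simp
  qed
  ultimately show ?case by auto
qed

section \<open>Averages over layers\<close>

text \<open>
  The number of points of the Hamming cube of dimension \<open>m\<^sub>1 + \<dots> + m\<^sub>n\<close> lying over \<open>x\<close>
  when the \<open>i\<close>-th block of \<open>m\<^sub>i\<close> bits is summed to the coordinate \<open>x\<^sub>i\<close>.
\<close>

definition binom_wt :: "nat \<Rightarrow> (nat \<Rightarrow> nat) \<Rightarrow> (nat \<Rightarrow> nat) \<Rightarrow> real" where
  "binom_wt n m x = (\<Prod>i\<in>{1..n}. real (m i choose x i))"

lemma finite_grid [simp]: "finite (grid n k)"
  unfolding grid_def by (intro finite_PiE) auto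

lemma finite_layers [simp]: "finite (layers n k E)"
  unfolding layers_def by auto

text \<open>Generalized Vandermonde identity: compare the coefficients of degree \<open>j\<close> in
  the product of the (1 + X)^(m_i). The \<open>Suc\<close> cancels the \<open>- 1\<close> in
  \<open>grid\<close>, so coordinate \<open>i\<close> runs over 0..m_i.\<close>

lemma sum_binom_wt:
  "(\<Sum>x\<in>layers n (\<lambda>i. Suc (m i)) {j}. binom_wt n m x) = real ((\<Sum>i\<in>{1..n}. m i) choose j)"
proof -
  let ?b = "\<lambda>i y. monom (real (m i choose y)) y"
  have one: "(\<Sum>y\<in>{0..a}. monom (real (a choose y)) y) = [:1, 1:] ^ a" for a
  proof -
    have "[:1, 1:] ^ a = (monom 1 1 + 1 :: real poly) ^ a"
      by (simp add: monom_altdef one_pCons)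
    also have "\<dots> = (\<Sum>y\<in>{0..a}. monom (real (a choose y)) y)"
      by (subst binomial_ring)
         (auto simp: atLeast0AtMost monom_power of_nat_poly smult_monom intro!: sum.cong)
    finally show ?thesis ..
  qed
  have pm: "(\<Prod>i\<in>A. ?b i (x i)) = monom (\<Prod>i\<in>A. real (m i choose x i)) (\<Sum>i\<in>A. x i)" for A x
    by (induction A rule: infinite_finite_induct) (auto simp: mult_monom)
  have "(\<Prod>i\<in>{1..n}. [:1, 1:] ^ m i) = (\<Prod>i\<in>{1..n}. \<Sum>y\<in>{0..m i}. ?b i y)"
    by (simp add: one)
  also have "\<dots> = (\<Sum>x\<in>grid n (\<lambda>i. Suc (m i)). \<Prod>i\<in>{1..n}. ?b i (x i))"
    unfolding grid_def by (subst prod_sum_PiE) auto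
  finally have "[:1, 1:] ^ (\<Sum>i\<in>{1..n}. m i) =
      (\<Sum>x\<in>grid n (\<lambda>i. Suc (m i)). monom (binom_wt n m x) (wt n x))"
    by (simp add: pm power_sum binom_wt_def wt_def)
  then have "coeff ([:1, 1:] ^ (\<Sum>i\<in>{1..n}. m i)) j =
      (\<Sum>x\<in>grid n (\<lambda>i. Suc (m i)). if wt n x = j then binom_wt n m x else 0)"
    by (simp add: coeff_sum)
  also have "\<dots> = (\<Sum>x\<in>layers n (\<lambda>i. Suc (m i)) {j}. binom_wt n m x)"
    unfolding layers_def by (subst sum.inter_filter[symmetric]) auto
  finally show ?thesis
    by (cases "j \<le> (\<Sum>i\<in>{1..n}. m i)")
       (auto simp flip: one simp: coeff_sum binomial_eq_0)
qed

text \<open>The absorption identity x * C(m, x) = m * C(m - 1, x - 1) in coordinate \<open>i\<close>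
  removes the factor \<open>x i\<close>; raising that coordinate by one identifies the smaller box
  with the points having \<open>x i\<close> nonzero.\<close>

lemma weighted_layer_sum_shift:
  assumes i: "i \<in> {1..n}" and "m i \<noteq> 0"
  defines "m' \<equiv> m(i := m i - 1)"
  shows "(\<Sum>x\<in>layers n (\<lambda>i. Suc (m i)) {Suc j}. binom_wt n m x * (real (x i) * g x)) =
         real (m i) * (\<Sum>x\<in>layers n (\<lambda>i. Suc (m' i)) {j}. binom_wt n m' x * g (x(i := Suc (x i))))"
proof -
  have wt_eq: "wt n (x(i := y)) + x i = wt n x + y" for x y
  proof -
    have "(\<Sum>l\<in>{1..n} - {i}. (x(i := y)) l) = (\<Sum>l\<in>{1..n} - {i}. x l)"
      by (intro sum.cong) auto
    moreover have w: "wt n z = z i + (\<Sum>l\<in>{1..n} - {i}. z l)" for z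
      unfolding wt_def using i by (intro sum.remove) auto
    ultimately show ?thesis unfolding w[of x] w[of "x(i := y)"] by simp
  qed
  have bw: "binom_wt n m x * real (x i) = real (m i) * binom_wt n m' (x(i := x i - 1))"
    if xi: "x i \<noteq> 0" for x
  proof -
    obtain a b where ab: "m i = Suc a" "x i = Suc b" using \<open>m i \<noteq> 0\<close> xi not0_implies_Suc by blast
    have "(Suc a choose Suc b) * Suc b = Suc a * (a choose b)"
      using Suc_times_binomial[of b a] by (simp only: mult.commute)
    then have at_i: "real (m i choose x i) * real (x i) = real (m i) * real (m' i choose (x(i := x i - 1)) i)"
      unfolding ab of_nat_mult[symmetric] of_nat_eq_iff by (simp add: m'_def ab del: binomial_Suc_Suc)
    have rest: "(\<Prod>l\<in>{1..n}-{i}. real (m' l choose ((x(i := x i - 1)) l))) =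
       (\<Prod>l\<in>{1..n}-{i}. real (m l choose x l))"
      by (intro prod.cong) (auto simp: m'_def)
    have split: "binom_wt n m x =
        real (m i choose x i) * (\<Prod>l\<in>{1..n}-{i}. real (m l choose x l))" for m x
      unfolding binom_wt_def using i by (intro prod.remove) auto
    have "binom_wt n m x * real (x i) =
        (real (m i choose x i) * real (x i)) * (\<Prod>l\<in>{1..n}-{i}. real (m l choose x l))"
      unfolding split[of m] by (simp only: mult_ac)
    also have "\<dots> = real (m i) * binom_wt n m' (x(i := x i - 1))"
      unfolding at_i split[of m'] rest by (simp only: mult_ac)
    finally show ?thesis .
  qed
  let ?L = "layers n (\<lambda>i. Suc (m i)) {Suc j}"
  \<comment> \<open>Terms with \<open>x i = 0\<close> vanish; on the others the truncated
    \<open>x i - 1\<close> is invertible.\<close>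
  have "(\<Sum>x\<in>?L. binom_wt n m x * (real (x i) * g x)) =
        (\<Sum>x\<in>{x\<in>?L. x i \<noteq> 0}. binom_wt n m x * (real (x i) * g x))"
    by (intro sum.mono_neutral_right) auto
  also have "\<dots> = (\<Sum>x\<in>layers n (\<lambda>i. Suc (m' i)) {j}.
      real (m i) * (binom_wt n m' x * g (x(i := Suc (x i)))))"
  proof (rule sum.reindex_bij_witness[of _ "\<lambda>x. x(i := Suc (x i))" "\<lambda>x. x(i := x i - 1)"])
    fix x assume x: "x \<in> {x\<in>?L. x i \<noteq> 0}"
    then show "(x(i := x i - 1))(i := Suc ((x(i := x i - 1)) i)) = x" by auto
    have "wt n (x(i := x i - 1)) = j" using x wt_eq[of x "x i - 1"] by (auto simp: layers_def)
    moreover have "x(i := x i - 1) \<in> grid n (\<lambda>i. Suc (m' i))"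
    proof -
      have "x l \<le> m l" if "l \<in> {1..n}" for l
        using x that by (auto simp: layers_def grid_def PiE_iff)
      then have "(x(i := x i - 1)) l \<le> m' l" if "l \<in> {1..n}" for l
        using that by (auto simp: m'_def diff_le_mono)
      then show ?thesis
        using x i by (simp add: layers_def grid_def PiE_iff extensional_def)
    qed
    ultimately show "x(i := x i - 1) \<in> layers n (\<lambda>i. Suc (m' i)) {j}"
      by (simp add: layers_def)
    show "real (m i) * (binom_wt n m' (x(i := x i - 1)) *
        g ((x(i := x i - 1))(i := Suc ((x(i := x i - 1)) i)))) = binom_wt n m x * (real (x i) * g x)"
    proof -
      have "(x(i := x i - 1))(i := Suc ((x(i := x i - 1)) i)) = x" using x by auto
      moreover have "binom_wt n m x * real (x i) = real (m i) * binom_wt n m' (x(i := x i - 1))"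
        using x by (intro bw) simp
      ultimately show ?thesis by (simp only: mult.assoc[symmetric])
    qed
  next
    fix x assume x: "x \<in> layers n (\<lambda>i. Suc (m' i)) {j}"
    then show "(x(i := Suc (x i)))(i := (x(i := Suc (x i))) i - 1) = x" by auto
    have "wt n (x(i := Suc (x i))) = Suc j" using x wt_eq[of x "Suc (x i)"] by (auto simp: layers_def)
    moreover have "x(i := Suc (x i)) \<in> grid n (\<lambda>i. Suc (m i))"
    proof -
      have *: "x l \<le> m' l" if "l \<in> {1..n}" for l
        using x that by (auto simp: layers_def grid_def PiE_iff)
      have "Suc (x i) \<le> m i" using *[OF i] \<open>m i \<noteq> 0\<close> by (auto simp: m'_def)
      moreover have "x l \<le> m l" if "l \<in> {1..n}" "l \<noteq> i" for l
        using *[of l] that by (auto simp: m'_def)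
      ultimately show ?thesis
        using x i by (auto simp: layers_def grid_def PiE_iff extensional_def)
    qed
    ultimately show "x(i := Suc (x i)) \<in> {x\<in>?L. x i \<noteq> 0}" by (auto simp: layers_def)
  qed
  finally show ?thesis by (simp add: sum_distrib_left)
qed

text \<open>By \<open>sum_binom_wt\<close> the binomial factor is the total weight of layer
  \<open>j\<close>, so \<open>p\<close> gives the weighted average of \<open>f\<close>. The box
  \<open>m\<close> and the shift \<open>s\<close> are both arbitrary because absorbing a factor
  \<open>x i\<close> shrinks the box and shifts the argument of \<open>f\<close>.\<close>

lemma polyfun_layer_sum:
  assumes "polyfun n d f"
  shows "\<exists>p :: real poly. degree p \<le> d \<and>
    (\<forall>j. (\<Sum>x\<in>layers n (\<lambda>i. Suc (m i)) {j}. binom_wt n m x * f (\<lambda>i. real (x i + s i))) =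
         real ((\<Sum>i\<in>{1..n}. m i) choose j) * poly p (real j))"
  using assms
proof (induction arbitrary: m s rule: polyfun.induct)
  case (const d c)
  show ?case
    by (rule exI[of _ "[:c:]"]) (simp add: sum_binom_wt flip: sum_distrib_right)
next
  case (add d f g)
  obtain p where p: "degree p \<le> d"
    "\<And>j. (\<Sum>x\<in>layers n (\<lambda>i. Suc (m i)) {j}. binom_wt n m x * f (\<lambda>i. real (x i + s i))) =
         real ((\<Sum>i\<in>{1..n}. m i) choose j) * poly p (real j)" using add.IH(1)[of m s] by blast
  obtain q where q: "degree q \<le> d"
    "\<And>j. (\<Sum>x\<in>layers n (\<lambda>i. Suc (m i)) {j}. binom_wt n m x * g (\<lambda>i. real (x i + s i))) =
         real ((\<Sum>i\<in>{1..n}. m i) choose j) * poly q (real j)" using add.IH(2)[of m s] by blast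
  show ?case
    by (rule exI[of _ "p + q"]) (use p q in \<open>simp add: degree_add_le distrib_left sum.distrib\<close>)
next
  case (var i d f)
  define m' where "m' = m(i := m i - 1)"
  define s' where "s' = s(i := Suc (s i))"
  define N where "N = (\<Sum>i\<in>{1..n}. m i)"
  obtain p where p: "degree p \<le> d"
    "\<And>j. (\<Sum>x\<in>layers n (\<lambda>i. Suc (m i)) {j}. binom_wt n m x * f (\<lambda>i. real (x i + s i))) =
         real (N choose j) * poly p (real j)" using var.IH[of m s] unfolding N_def by blast
  obtain q where q: "degree q \<le> d"
    "\<And>j. (\<Sum>x\<in>layers n (\<lambda>i. Suc (m' i)) {j}. binom_wt n m' x * f (\<lambda>i. real (x i + s' i))) =
         real ((\<Sum>i\<in>{1..n}. m' i) choose j) * poly q (real j)" using var.IH[of m' s'] by blast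
  \<comment> \<open>The factor \<open>x i\<close> contributes m_i * C(N - 1, j - 1) * q(j - 1), and
    C(N - 1, j - 1) = (j / N) * C(N, j) when \<open>N\<close> and \<open>j\<close> are positive; the
    constant \<open>s i\<close> contributes a multiple of \<open>p\<close>.\<close>
  define r where "r = smult (real (m i) / real N) ([:0, 1:] * pcompose q [:-1, 1:]) + smult (real (s i)) p"
  have "degree (pcompose q [:-1, 1:]) \<le> d" using q(1) by (simp add: degree_pcompose)
  then have deg: "degree ([:0, 1:] * pcompose q [:-1, 1:]) \<le> Suc d"
    using degree_mult_le[of "[:0, 1:]" "pcompose q [:-1, 1:]"] by simp
  have "degree r \<le> Suc d"
    unfolding r_def using p(1) deg by (intro degree_add_le order.trans[OF degree_smult_le]) auto
  moreover have "(\<Sum>x\<in>layers n (\<lambda>i. Suc (m i)) {j}. binom_wt n m x *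
      (real (x i + s i) * f (\<lambda>i. real (x i + s i)))) = real (N choose j) * poly r (real j)" for j
  proof -
    let ?S = "\<Sum>x\<in>layers n (\<lambda>i. Suc (m i)) {j}. binom_wt n m x *
      (real (x i) * f (\<lambda>i. real (x i + s i)))"
    have S: "?S = real (N choose j) * (real (m i) / real N * (real j * poly q (real j - 1)))"
    \<comment> \<open>In the first case \<open>x i\<close> is 0 throughout the layer and both sides
      vanish; this includes \<open>N = 0\<close>, where division by \<open>N\<close> yields
      0.\<close>
    proof (cases "m i = 0 \<or> j = 0")
      case True
      have "x i = 0" if x: "x \<in> layers n (\<lambda>i. Suc (m i)) {j}" for x
      proof -
        have "x i \<le> wt n x"
          unfolding wt_def using \<open>i \<in> {1..n}\<close> by (intro member_le_sum) auto
        moreover have "x i \<le> m i" "wt n x = j"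
          using x \<open>i \<in> {1..n}\<close> by (auto simp: layers_def grid_def PiE_iff)
        ultimately show ?thesis using True by auto
      qed
      then have "?S = 0" by (intro sum.neutral) auto
      moreover have "real (m i) / real N * (real j * poly q (real j - 1)) = 0" using True by auto
      ultimately show ?thesis by (simp only: mult_zero_right)
    next
      case False
      then obtain j' where j: "j = Suc j'" by (cases j) auto
      have N: "N = Suc (\<Sum>i\<in>{1..n}. m' i)"
      proof -
        have "(\<Sum>l\<in>{1..n} - {i}. m' l) = (\<Sum>l\<in>{1..n} - {i}. m l)"
          by (intro sum.cong) (auto simp: m'_def)
        moreover have "N = m i + (\<Sum>l\<in>{1..n} - {i}. m l)"
          unfolding N_def using \<open>i \<in> {1..n}\<close> by (intro sum.remove) auto
        moreover have "(\<Sum>l\<in>{1..n}. m' l) = m' i + (\<Sum>l\<in>{1..n} - {i}. m' l)"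
          using \<open>i \<in> {1..n}\<close> by (intro sum.remove) auto
        moreover have "m i = Suc (m' i)" using False by (simp add: m'_def)
        ultimately show ?thesis by linarith
      qed
      have shift: "(\<lambda>l. real ((x(i := Suc (x i))) l + s l)) = (\<lambda>l. real (x l + s' l))" for x
        by (auto simp: s'_def)
      have "?S = real (m i) * (\<Sum>x\<in>layers n (\<lambda>i. Suc (m' i)) {j'}. binom_wt n m' x *
          f (\<lambda>l. real (x l + s' l)))"
        using weighted_layer_sum_shift[OF \<open>i \<in> {1..n}\<close>,
            of m "\<lambda>x. f (\<lambda>l. real (x l + s l))" j'] False
        unfolding j m'_def[symmetric] shift by simp
      also have "\<dots> = real (m i) * (real ((N - 1) choose j') * poly q (real j'))"
        unfolding q(2) by (simp add: N)
      finally have *: "?S = real (m i) * (real ((N - 1) choose j') * poly q (real j'))" .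
      have "real j * real (N choose j) = real N * real ((N - 1) choose j')"
        unfolding j N of_nat_mult[symmetric] of_nat_eq_iff
        using Suc_times_binomial[of j' "\<Sum>i\<in>{1..n}. m' i"] by simp
      then have "real ((N - 1) choose j') = real j * real (N choose j) / real N"
        using of_nat_neq_0[of "\<Sum>i\<in>{1..n}. m' i", where 'a = real]
        unfolding N by (simp only: nonzero_mult_div_cancel_left not_False_eq_True)
      moreover have "real j' = real j - 1" unfolding j by simp
      ultimately show ?thesis
        unfolding * by (simp only: times_divide_eq_left times_divide_eq_right mult_ac)
    qed
    have "binom_wt n m x * (real (x i + s i) * a) =
        binom_wt n m x * (real (x i) * a) + real (s i) * (binom_wt n m x * a)" for x a
      by (simp add: algebra_simps)
    then have "(\<Sum>x\<in>layers n (\<lambda>i. Suc (m i)) {j}. binom_wt n m x *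
        (real (x i + s i) * f (\<lambda>i. real (x i + s i)))) =
        ?S + real (s i) * (\<Sum>x\<in>layers n (\<lambda>i. Suc (m i)) {j}. binom_wt n m x * f (\<lambda>i. real (x i + s i)))"
      unfolding sum_distrib_left sum.distrib[symmetric] by (intro sum.cong refl)
    also have "\<dots> = real (N choose j) * (real (m i) / real N * (real j * poly q (real j - 1)) +
        real (s i) * poly p (real j))"
      unfolding S p(2) by (simp add: distrib_left mult.left_commute)
    also have "real (m i) / real N * (real j * poly q (real j - 1)) + real (s i) * poly p (real j) =
        poly r (real j)"
      by (simp add: r_def poly_pcompose)
    finally show ?thesis .
  qed
  ultimately show ?case unfolding N_def by blast
qed



section \<open>Propagation of zeros between layers\<close>

lemma poly_eq_0_if_many_nat_roots:
  fixes p :: "real poly"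
  assumes "degree p \<le> d" "d < card T" "\<And>t. t \<in> T \<Longrightarrow> poly p (real t) = 0"
  shows "p = 0"
proof (rule ccontr)
  assume p: "p \<noteq> 0"
  have "card T = card (real ` T)" by (simp add: card_image)
  also have "\<dots> \<le> card {x. poly p x = 0}"
    using p assms(3) by (intro card_mono poly_roots_finite) auto
  also have "\<dots> \<le> degree p" using p by (rule card_poly_roots_bound)
  finally show False using assms by linarith
qed

lemma wt_le_grid_N: "x \<in> grid n k \<Longrightarrow> wt n x \<le> grid_N n k"
  unfolding wt_def grid_N_def grid_def by (intro sum_mono) auto

lemma layers_zero: "layers n k {0} = {\<lambda>i\<in>{1..n}. 0}"
  by (auto simp: layers_def grid_def PiE_iff wt_def extensional_def)

text \<open>Average over the box of points above \<open>a\<close>: its layer \<open>j\<close> lies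
  in layer \<open>wt n a + j\<close> of the grid. More than \<open>d\<close> roots make the
  averaging polynomial zero, and at 0 it averages over the single point \<open>a\<close>.\<close>

lemma polyfun_eq_0_if_zeros_above:
  assumes f: "polyfun n d f" and a: "a \<in> grid n k"
    and T: "d < card T" "T \<subseteq> {wt n a<..grid_N n k}"
    and zero: "\<And>x. x \<in> layers n k T \<Longrightarrow> f (\<lambda>i. real (x i)) = 0"
  shows "f (\<lambda>i. real (a i)) = 0"
proof -
  define m where "m = (\<lambda>i. k i - 1 - a i)"
  have ak: "a i \<le> k i - 1" if "i \<in> {1..n}" for i using a that by (auto simp: grid_def)
  have m_sum: "(\<Sum>i\<in>{1..n}. m i) = grid_N n k - wt n a"
    unfolding m_def grid_N_def wt_def using ak by (intro sum_subtractf_nat)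
  obtain p where p: "degree p \<le> d"
    "\<And>j. (\<Sum>x\<in>layers n (\<lambda>i. Suc (m i)) {j}. binom_wt n m x * f (\<lambda>i. real (x i + a i))) =
         real ((\<Sum>i\<in>{1..n}. m i) choose j) * poly p (real j)"
    using polyfun_layer_sum[OF f, of m a] by blast
  have "p = 0"
  proof (rule poly_eq_0_if_many_nat_roots[OF p(1)])
    have "inj_on (\<lambda>t. t - wt n a) T" using T(2) by (fastforce simp: inj_on_def)
    then show "d < card ((\<lambda>t. t - wt n a) ` T)" using T(1) by (simp add: card_image)
    fix j assume "j \<in> (\<lambda>t. t - wt n a) ` T"
    then obtain t where t: "t \<in> T" "j = t - wt n a" by auto
    have "f (\<lambda>i. real (x i + a i)) = 0" if x: "x \<in> layers n (\<lambda>i. Suc (m i)) {j}" for x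
    proof -
      \<comment> \<open>The restriction makes \<open>x + a\<close> extensional, hence a point of the
        grid.\<close>
      define z where "z = (\<lambda>i\<in>{1..n}. x i + a i)"
      have "x i \<le> m i" if "i \<in> {1..n}" for i using x that by (auto simp: layers_def grid_def)
      then have "x i + a i \<le> k i - 1" if "i \<in> {1..n}" for i
        using ak[OF that] that by (fastforce simp: m_def)
      moreover have "wt n z = t"
        using x t T(2) by (auto simp: wt_def z_def layers_def sum.distrib)
      ultimately have "z \<in> layers n k T" using t by (auto simp: layers_def grid_def z_def)
      then have "f (\<lambda>i. real (z i)) = 0" by (rule zero)
      moreover have "f (\<lambda>i. real (z i)) = f (\<lambda>i. real (x i + a i))"
        by (rule polyfun_cong[OF f]) (auto simp: z_def)
      ultimately show ?thesis by simp
    qed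
    then have "real ((\<Sum>i\<in>{1..n}. m i) choose j) * poly p (real j) = 0"
      by (subst p(2)[symmetric]) (auto intro!: sum.neutral)
    moreover have "j \<le> (\<Sum>i\<in>{1..n}. m i)" unfolding m_sum t(2) using t(1) T(2) by (intro diff_le_mono) auto
    ultimately show "poly p (real j) = 0" by (auto simp: binomial_eq_0_iff)
  qed
  then have "binom_wt n m (\<lambda>i\<in>{1..n}. 0) * f (\<lambda>i. real ((\<lambda>i\<in>{1..n}. 0) i + a i)) = 0"
    using p(2)[of 0] by (simp add: layers_zero)
  moreover have "f (\<lambda>i. real ((\<lambda>i\<in>{1..n}. 0) i + a i)) = f (\<lambda>i. real (a i))"
    by (rule polyfun_cong[OF f]) auto
  ultimately show ?thesis by (simp add: binom_wt_def)
qed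

text \<open>The same argument on the box of points below \<open>a\<close>, where no shift is
  required and \<open>a\<close> alone forms the top layer.\<close>

lemma polyfun_eq_0_if_zeros_below:
  assumes f: "polyfun n d f" and a: "a \<in> grid n k"
    and T: "d < card T" "T \<subseteq> {..<wt n a}"
    and zero: "\<And>x. x \<in> layers n k T \<Longrightarrow> f (\<lambda>i. real (x i)) = 0"
  shows "f (\<lambda>i. real (a i)) = 0"
proof -
  have ak: "a i \<le> k i - 1" if "i \<in> {1..n}" for i using a that by (auto simp: grid_def)
  obtain p where p: "degree p \<le> d"
    "\<And>j. (\<Sum>x\<in>layers n (\<lambda>i. Suc (a i)) {j}. binom_wt n a x * f (\<lambda>i. real (x i))) =
         real (wt n a choose j) * poly p (real j)"
    using polyfun_layer_sum[OF f, of a "\<lambda>_. 0"] by (auto simp: wt_def)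
  have "p = 0"
  proof (rule poly_eq_0_if_many_nat_roots[OF p(1) T(1)])
    fix t assume t: "t \<in> T"
    have "x \<in> layers n k T" if "x \<in> layers n (\<lambda>i. Suc (a i)) {t}" for x
      using that t ak by (fastforce simp: layers_def grid_def PiE_iff)
    then have "real (wt n a choose t) * poly p (real t) = 0"
      by (subst p(2)[symmetric]) (auto intro!: sum.neutral simp: zero)
    then show "poly p (real t) = 0" using t T(2) by (auto simp: binomial_eq_0_iff)
  qed
  moreover have "layers n (\<lambda>i. Suc (a i)) {wt n a} = {a}"
  proof -
    have "x = a" if x: "x \<in> layers n (\<lambda>i. Suc (a i)) {wt n a}" for x
    proof (rule ccontr)
      assume "x \<noteq> a"
      moreover have "x \<in> extensional {1..n}" "a \<in> extensional {1..n}"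
        using x a by (auto simp: layers_def grid_def PiE_iff)
      ultimately obtain i where i: "i \<in> {1..n}" "x i \<noteq> a i" by (meson extensionalityI)
      have le: "\<forall>i\<in>{1..n}. x i \<le> a i" using x by (auto simp: layers_def grid_def PiE_iff)
      then have "wt n x < wt n a"
        unfolding wt_def using i by (intro sum_strict_mono_ex1) (auto simp: le_neq_trans intro!: bexI[of _ i])
      with x show False by (simp add: layers_def)
    qed
    then show ?thesis using a by (auto simp: layers_def grid_def PiE_iff)
  qed
  ultimately show ?thesis using p(2)[of "wt n a"] by (simp add: binom_wt_def)
qed

section \<open>Polynomials supported on central layers\<close>

text \<open>A homogeneous linear system with more unknowns than equations, solved by Gaussian
  elimination with induction on the equations.\<close>

lemma exists_nontrivial_kernel:
  fixes M :: "'a \<Rightarrow> 'b \<Rightarrow> real"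
  assumes "finite B" "finite A" "card B < card A"
  shows "\<exists>c. (\<exists>a\<in>A. c a \<noteq> 0) \<and> (\<forall>b\<in>B. (\<Sum>a\<in>A. c a * M a b) = 0)"
  using assms
proof (induction B arbitrary: A M rule: finite_induct)
  case empty
  then have "A \<noteq> {}" by auto
  then show ?case by (intro exI[of _ "\<lambda>_. 1"]) auto
next
  case (insert b B)
  show ?case
  proof (cases "\<forall>a\<in>A. M a b = 0")
    case True
    moreover have "card B < card A" using insert by simp
    then obtain c where "\<exists>a\<in>A. c a \<noteq> 0" "\<forall>b\<in>B. (\<Sum>a\<in>A. c a * M a b) = 0"
      using insert.IH[of A M] insert.prems(1) by blast
    ultimately show ?thesis by (intro exI[of _ c]) auto
  next
    case False
    then obtain e where e: "e \<in> A" "M e b \<noteq> 0" by auto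
    \<comment> \<open>Equation \<open>b\<close> with pivot \<open>e\<close> eliminates the unknown
      \<open>e\<close> from the remaining equations.\<close>
    define M' where "M' = (\<lambda>a b'. M a b' - M a b / M e b * M e b')"
    have "card B < card (A - {e})" using insert e by simp
    then obtain c where c: "\<exists>a\<in>A-{e}. c a \<noteq> 0" "\<And>b'. b' \<in> B \<Longrightarrow> (\<Sum>a\<in>A-{e}. c a * M' a b') = 0"
      using insert.IH[of "A - {e}" M'] insert.prems by auto
    define s where "s = (\<Sum>a\<in>A-{e}. c a * M a b)"
    \<comment> \<open>Back substitution: the value at the pivot is the one that satisfies equation
      \<open>b\<close>.\<close>
    define c' where "c' = c(e := - s / M e b)"
    have split: "(\<Sum>a\<in>A. c' a * M a b') = (\<Sum>a\<in>A-{e}. c a * M a b') - s / M e b * M e b'" for b'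
    proof -
      have "(\<Sum>a\<in>A-{e}. c' a * M a b') = (\<Sum>a\<in>A-{e}. c a * M a b')"
        by (intro sum.cong) (auto simp: c'_def)
      then show ?thesis
        using e insert.prems by (subst sum.remove[of A e]) (auto simp: c'_def)
    qed
    have "(\<Sum>a\<in>A. c' a * M a b') = 0" if "b' \<in> insert b B" for b'
    proof (cases "b' = b")
      case True
      then show ?thesis using e by (simp add: split s_def)
    next
      case False
      have "(\<Sum>a\<in>A-{e}. c a * M' a b') = (\<Sum>a\<in>A-{e}. c a * M a b') - s / M e b * M e b'"
        by (simp add: M'_def s_def algebra_simps sum_subtractf sum_divide_distrib sum_distrib_left)
      with c(2)[of b'] False that show ?thesis by (simp add: split)
    qed
    moreover have "\<exists>a\<in>A. c' a \<noteq> 0" using c(1) by (auto simp: c'_def)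
    ultimately show ?thesis by blast
  qed
qed

text \<open>Replacing each coordinate \<open>x i\<close> by \<open>k i - 1 - x i\<close> is an
  involution of the grid that exchanges the two layers.\<close>

lemma card_layers_reflect:
  assumes "j \<le> grid_N n k"
  shows "card (layers n k {grid_N n k - j}) = card (layers n k {j})"
proof -
  define h where "h x = (\<lambda>i\<in>{1..n}. k i - 1 - x i)" for x :: "nat \<Rightarrow> nat"
  have bound: "x i \<le> k i - 1" if "x \<in> grid n k" "i \<in> {1..n}" for x i
    using that by (auto simp: grid_def)
  have h_grid: "h x \<in> grid n k" for x by (auto simp: h_def grid_def)
  have h_wt: "wt n (h x) = grid_N n k - wt n x" if "x \<in> grid n k" for x
  proof -
    have "wt n (h x) = (\<Sum>i\<in>{1..n}. k i - 1 - x i)" by (auto simp: wt_def h_def)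
    also have "\<dots> = grid_N n k - wt n x"
      unfolding grid_N_def wt_def using bound[OF that] by (intro sum_subtractf_nat)
    finally show ?thesis .
  qed
  have h_h: "h (h x) = x" if "x \<in> grid n k" for x
  proof (rule extensionalityI[of _ "{1..n}"])
    show "h (h x) i = x i" if "i \<in> {1..n}" for i
      using bound[OF \<open>x \<in> grid n k\<close> that] that by (simp add: h_def)
  qed (use that in \<open>auto simp: h_def grid_def PiE_iff\<close>)
  have "bij_betw h (layers n k {grid_N n k - j}) (layers n k {j})"
    by (rule bij_betwI[of _ _ _ h])
       (use assms in \<open>auto simp: layers_def h_grid h_wt h_h\<close>)
  then show ?thesis by (rule bij_betw_same_card)
qed

text \<open>By reflection layer N - r + 1 has the size of layer r - 1, which is smaller on the
  increasing half. For \<open>r = 0\<close> it is empty, while layer 0 is a single point.\<close>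

lemma card_reflected_layer_less:
  assumes "strictly_unimodal n k" "r \<le> grid_N n k div 2"
  shows "card (layers n k {Suc (grid_N n k - r)}) < card (layers n k {r})"
proof (cases r)
  case 0
  then have "layers n k {Suc (grid_N n k - r)} = {}"
    using wt_le_grid_N by (fastforce simp: layers_def)
  with 0 show ?thesis by (simp add: layers_zero)
next
  case (Suc q)
  with assms(2) have "Suc (grid_N n k - r) = grid_N n k - q" "q \<le> grid_N n k" by auto
  with Suc assms show ?thesis
    by (simp add: card_layers_reflect strictly_unimodal_def Let_def)
qed

text \<open>Degree \<open>r\<close> suffices to kill the 2r outer layers; a product of one linear
  factor per layer would cost degree 2r.\<close>

lemma exists_central_polyfun:
  assumes su: "strictly_unimodal n k" and r: "r \<le> j" "r + j \<le> grid_N n k"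
  shows "\<exists>f. polyfun n r f \<and>
    (\<forall>x\<in>grid n k. wt n x \<notin> {r..grid_N n k - r} \<longrightarrow> f (\<lambda>i. real (x i)) = 0) \<and>
    (\<exists>x\<in>layers n k {j}. f (\<lambda>i. real (x i)) \<noteq> 0)"
proof -
  define N where "N = grid_N n k"
  define M where "M = (\<lambda>a x. \<Prod>i\<in>{1..n}. real (x i) gchoose a i)"
  have "r \<le> N div 2" using r by (simp add: N_def)
  then have "card (layers n k {Suc (N - r)}) < card (layers n k {r})"
    using card_reflected_layer_less[OF su] by (simp add: N_def)
  then obtain c where c: "\<exists>a\<in>layers n k {r}. c a \<noteq> 0"
    "\<And>x. x \<in> layers n k {Suc (N - r)} \<Longrightarrow> (\<Sum>a\<in>layers n k {r}. c a * M a x) = 0"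
    using exists_nontrivial_kernel[OF finite_layers finite_layers, of n k _ n k _ M] by blast
  \<comment> \<open>Vanishing below layer \<open>r\<close> is automatic, and the \<open>r + 1\<close> layers \<open>0, \<dots>, r - 1, N - r + 1\<close>
    force zeros on all higher layers, so only layer \<open>N - r + 1\<close> imposes conditions on \<open>c\<close>.\<close>
  define f where "f = (\<lambda>x::nat \<Rightarrow> real. \<Sum>a\<in>layers n k {r}. c a * (\<Prod>i\<in>{1..n}. x i gchoose a i))"
  have f_eq: "f (\<lambda>i. real (x i)) = (\<Sum>a\<in>layers n k {r}. c a * M a x)" for x
    by (simp add: f_def M_def)
  have f: "polyfun n r f"
    unfolding f_def
  proof (intro polyfun_sum polyfun_scale)
    fix a assume "a \<in> layers n k {r}"
    then have "(\<Sum>i\<in>{1..n}. a i) = r" by (simp add: layers_def wt_def)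
    moreover have "polyfun n (\<Sum>i\<in>{1..n}. a i) (\<lambda>x. \<Prod>i\<in>{1..n}. x i gchoose a i)"
      by (intro polyfun_prod polyfun_gbinomial)
    ultimately show "polyfun n r (\<lambda>x. \<Prod>i\<in>{1..n}. x i gchoose a i)" by simp
  qed
  \<comment> \<open>A nonzero product of binomials requires \<open>a\<close> to lie coordinatewise
    below \<open>x\<close>; with \<open>wt n x\<close> at most \<open>r\<close>, this forces
    \<open>a = x\<close>. So \<open>M\<close> is the identity matrix on layer
    \<open>r\<close>.\<close>
  have M_0: "M a x = 0" if "a \<in> layers n k {r}" "x \<in> grid n k" "wt n x \<le> r" "a \<noteq> x" for a x
  proof (rule ccontr)
    assume "M a x \<noteq> 0"
    then have le: "\<forall>i\<in>{1..n}. a i \<le> x i"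
      by (auto simp: M_def binomial_eq_0_iff simp flip: binomial_gbinomial)
    have "x \<in> extensional {1..n}" "a \<in> extensional {1..n}"
      using that by (auto simp: layers_def grid_def PiE_iff)
    with \<open>a \<noteq> x\<close> obtain i where i: "i \<in> {1..n}" "a i \<noteq> x i" by (meson extensionalityI)
    then have "wt n a < wt n x"
      unfolding wt_def using le
      by (intro sum_strict_mono_ex1) (auto simp: le_neq_trans intro!: bexI[of _ i])
    with that show False by (simp add: layers_def)
  qed
  have f_low: "f (\<lambda>i. real (x i)) = 0" if "x \<in> grid n k" "wt n x < r" for x
    unfolding f_eq using that M_0[of _ x] by (intro sum.neutral) (auto simp: layers_def)
  have f_r: "f (\<lambda>i. real (x i)) = c x" if x: "x \<in> layers n k {r}" for x
  proof -
    have "f (\<lambda>i. real (x i)) = (\<Sum>a\<in>{x}. c a * M a x)"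
      unfolding f_eq using x M_0[of _ x] by (intro sum.mono_neutral_right) (auto simp: layers_def)
    moreover have "M x x = 1" by (simp add: M_def flip: binomial_gbinomial)
    ultimately show ?thesis by simp
  qed
  have f_high: "f (\<lambda>i. real (x i)) = 0" if x: "x \<in> grid n k" "N - r < wt n x" for x
  proof (cases "wt n x = Suc (N - r)")
    case True
    then show ?thesis unfolding f_eq using x c(2) by (auto simp: layers_def)
  next
    case False
    let ?T = "insert (Suc (N - r)) {..<r}"
    show ?thesis
    proof (rule polyfun_eq_0_if_zeros_below[OF f x(1), of ?T])
      show "r < card ?T" using r by (auto simp: N_def)
      show "?T \<subseteq> {..<wt n x}" using x(2) False r by (auto simp: N_def)
      show "f (\<lambda>i. real (y i)) = 0" if "y \<in> layers n k ?T" for y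
        using that f_low[of y] c(2)[of y] by (auto simp: layers_def f_eq)
    qed
  qed
  \<comment> \<open>Otherwise the \<open>r + 1\<close> layers \<open>j, N - r + 1, \<dots>, N\<close> force zeros on layer \<open>r\<close>, where \<open>f\<close> equals \<open>c\<close>.\<close>
  have "\<exists>x\<in>layers n k {j}. f (\<lambda>i. real (x i)) \<noteq> 0"
  proof (rule ccontr)
    assume *: "\<not> ?thesis"
    \<comment> \<open>For \<open>j = r\<close> the nonzero coefficient of \<open>c\<close> already
      gives a nonzero value.\<close>
    have j: "r < j" using * r(1) c(1) f_r by (cases "r = j") auto
    obtain a where a: "a \<in> layers n k {r}" "c a \<noteq> 0" using c(1) by blast
    let ?T = "insert j {N - r<..N}"
    have "f (\<lambda>i. real (a i)) = 0"
    proof (rule polyfun_eq_0_if_zeros_above[OF f, of a k ?T])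
      show "a \<in> grid n k" using a by (simp add: layers_def)
      show "r < card ?T" using r by (auto simp: N_def)
      show "?T \<subseteq> {wt n a<..grid_N n k}" using a j r by (auto simp: N_def layers_def)
      show "f (\<lambda>i. real (y i)) = 0" if "y \<in> layers n k ?T" for y
        using that f_high[of y] * by (auto simp: layers_def)
    qed
    with a f_r show False by simp
  qed
  with f f_low f_high show ?thesis
    by (intro exI[of _ f]) (auto simp: N_def not_le)
qed

section \<open>Closed sets of layers\<close>

text \<open>The sorted list is strictly increasing, so elements of \<open>E\<close> compare as their
  positions do.\<close>

lemma nth_elem_props:
  assumes "finite E" "1 \<le> i" "i \<le> card E"
  shows "nth_elem E i \<in> E"
    and "card {t\<in>E. nth_elem E i < t} = card E - i"
    and "card {t\<in>E. t < nth_elem E i} = i - 1"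
proof -
  define xs where "xs = sorted_list_of_set E"
  have xs: "set xs = E" "length xs = card E" "sorted_wrt (<) xs"
    using assms(1) by (auto simp: xs_def)
  have less: "xs ! l < xs ! l' \<longleftrightarrow> l < l'" if "l < length xs" "l' < length xs" for l l'
    using sorted_wrt_nth_less[OF xs(3)] that by (metis linorder_neqE_nat order_less_asym)
  have inj: "inj_on ((!) xs) {..<length xs}"
    using less by (metis inj_onI lessThan_iff linorder_neqE_nat order_less_irrefl)
  have E: "E = (!) xs ` {..<length xs}" using xs(1) by (auto simp: set_conv_nth)
  have nth: "nth_elem E i = xs ! (i - 1)" by (simp add: nth_elem_def xs_def)
  have i: "i - 1 < length xs" using assms xs by auto
  show "nth_elem E i \<in> E" using nth_mem[OF i] unfolding nth xs(1) .
  have "{t\<in>E. nth_elem E i < t} = (!) xs ` {i..<length xs}"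
    unfolding nth using less[OF i] assms(2) by (auto simp: E)
  also have "card \<dots> = card E - i"
    using card_image[OF inj_on_subset[OF inj, of "{i..<length xs}"]] xs(2)
    by (simp add: subset_iff)
  finally show "card {t\<in>E. nth_elem E i < t} = card E - i" .
  have "{t\<in>E. t < nth_elem E i} = (!) xs ` {..<i - 1}"
    unfolding nth using less[OF _ i] i by (auto simp: E)
  also have "card \<dots> = i - 1"
    using card_image[OF inj_on_subset[OF inj], of "{..<i - 1}"] i by auto
  finally show "card {t\<in>E. t < nth_elem E i} = i - 1" .
qed

lemma L_op_superset: "E \<subseteq> L_op M d E"
  by (auto simp: L_op_def)

lemma L_op_subset: "E \<subseteq> {0..M} \<Longrightarrow> L_op M d E \<subseteq> {0..M}"
proof -
  assume E: "E \<subseteq> {0..M}"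
  show ?thesis
  proof (cases "card E - d = 0")
    case False
    then have "nth_elem E (card E - d) \<in> E"
      using E by (intro nth_elem_props) (auto intro: finite_subset)
    with E show ?thesis by (auto simp: L_op_def)
  qed (use E in \<open>auto simp: L_op_def\<close>)
qed

lemma L_op_funpow_subset: "E \<subseteq> {0..M} \<Longrightarrow> (L_op M d ^^ i) E \<subseteq> {0..M}"
  by (induction i) (simp_all add: L_op_subset)

lemma L_bar_subset: "E \<subseteq> {0..M} \<Longrightarrow> L_bar M d E \<subseteq> {0..M}"
  using L_op_funpow_subset unfolding L_bar_def by blast

lemma L_bar_superset: "E \<subseteq> L_bar M d E"
proof -
  have "(L_op M d ^^ 0) E \<subseteq> L_bar M d E" unfolding L_bar_def by blast
  then show ?thesis by simp
qed

text \<open>The iterates increase inside the finite set \<open>{0..M}\<close>, so their union is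
  itself one of the iterates.\<close>

lemma L_op_L_bar:
  assumes "E \<subseteq> {0..M}"
  shows "L_op M d (L_bar M d E) = L_bar M d E"
proof -
  let ?F = "\<lambda>i. (L_op M d ^^ i) E"
  have "mono ?F" by (rule incseq_SucI) (simp add: L_op_superset)
  have "finite (range ?F)"
    by (rule finite_subset[of _ "Pow {0..M}"]) (use L_op_funpow_subset[OF assms] in auto)
  moreover have "subset.chain UNIV (range ?F)"
  proof -
    have "?F i \<subseteq> ?F l \<or> ?F l \<subseteq> ?F i" for i l
      using monoD[OF \<open>mono ?F\<close>, of i l] monoD[OF \<open>mono ?F\<close>, of l i] nat_le_linear[of i l] by blast
    then show ?thesis unfolding subset_chain_def by blast
  qed
  ultimately have "\<Union>(range ?F) \<in> range ?F"
    by (intro Union_in_chain[of _ UNIV]) auto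
  then obtain i where i: "L_bar M d E = ?F i" by (auto simp: L_bar_def)
  have "L_op M d (?F i) = ?F (Suc i)" by simp
  also have "\<dots> \<subseteq> L_bar M d E" unfolding L_bar_def by blast
  finally show ?thesis using L_op_superset[of "?F i" M d] i by auto
qed

text \<open>Let \<open>p\<close> and \<open>q\<close> be the first and last gaps of
  \<open>F\<close>. Closedness keeps the initial segment added by \<open>L_op\<close> below
  \<open>p\<close> and the final one above \<open>q\<close>; counting elements of \<open>F\<close>
  then bounds its part between the gaps.\<close>

lemma closed_set_radius:
  assumes F: "F \<subseteq> {0..N}" "L_op N d F = F" and j: "j \<le> N" "j \<notin> F"
  obtains r where "r \<le> j" "r + j \<le> N" "r + card (F \<inter> {r..N - r}) \<le> d"
proof (cases "card F \<le> d")
  case True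
  have "F \<inter> {0..N} = F" using F by auto
  with True j show thesis by (intro that[of 0]) auto
next
  case False
  have fin: "finite F" using F(1) by (rule finite_subset) auto
  define p where "p = Min ({0..N} - F)"
  define q where "q = Max ({0..N} - F)"
  have ne: "{0..N} - F \<noteq> {}" using j by auto
  have p: "p \<le> N" "p \<notin> F" "p \<le> j" and q: "q \<le> N" "q \<notin> F" "j \<le> q"
    using Min_in[OF _ ne] Max_in[OF _ ne] j by (auto simp: p_def q_def)
  have below_p: "t \<in> F" if "t < p" for t
    using that p Min_le[of "{0..N} - F" t] by (fastforce simp: p_def)
  have above_q: "t \<in> F" if "q < t" "t \<le> N" for t
    using that Max_ge[of "{0..N} - F" t] by (fastforce simp: q_def)
  define u where "u = nth_elem F (card F - d)"
  define v where "v = nth_elem F (d + 1)"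
  have uv: "{0..u} \<subseteq> F" "{v..N} \<subseteq> F"
    using F(2) False by (auto simp: L_op_def u_def v_def split: if_splits)
  have "u < p" using subsetD[OF uv(1), of p] p(2) by (cases "u < p") auto
  have "q < v" using subsetD[OF uv(2), of q] q(1,2) by (cases "q < v") auto
  define F' where "F' = F \<inter> {p..q}"
  \<comment> \<open>Exactly \<open>d\<close> elements of \<open>F\<close> exceed \<open>u\<close>;
    among them are all of \<open>F'\<close> and all of \<open>{q<..N}\<close>.\<close>
  have **: "card F' + (N - q) \<le> d"
  proof -
    have "card F' + (N - q) = card (F' \<union> {q<..N})"
      by (subst card_Un_disjoint) (auto simp: F'_def)
    also have "\<dots> \<le> card {t\<in>F. u < t}"
      using \<open>u < p\<close> p q above_q fin by (intro card_mono) (auto simp: F'_def)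
    also have "\<dots> = d" using False fin unfolding u_def by (subst nth_elem_props) auto
    finally show ?thesis .
  qed
  have *: "card F' + p \<le> d"
  proof -
    have "card F' + p = card (F' \<union> {..<p})"
      by (subst card_Un_disjoint) (auto simp: F'_def)
    also have "\<dots> \<le> card {t\<in>F. t < v}"
      using \<open>q < v\<close> p q below_p fin by (intro card_mono) (auto simp: F'_def)
    also have "\<dots> = d" using False fin unfolding v_def by (subst nth_elem_props) auto
    finally show ?thesis .
  qed
  \<comment> \<open>The largest radius allowed by \<open>r \<le> j\<close>,
    \<open>r + j \<le> N\<close> and \<open>r + card F' \<le> d\<close>. Whichever bound is
    attained, at least one of the margins \<open>p - r\<close> and \<open>N - r - q\<close> is
    0.\<close>
  define r where "r = min (d - card F') (min j (N - j))"
  have "card (F \<inter> {r..N - r}) \<le> card F' + (p - r) + (N - r - q)"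
  proof -
    have "card (F \<inter> {r..N - r}) \<le> card (F' \<union> {r..<p} \<union> {q<..N - r})"
      using fin by (intro card_mono) (auto simp: F'_def)
    also have "\<dots> \<le> card F' + card {r..<p} + card {q<..N - r}"
      by (intro order.trans[OF card_Un_le] add_mono card_Un_le order.refl)
    finally show ?thesis by simp
  qed
  moreover have "r \<le> j" "r + j \<le> N" using j(1) by (auto simp: r_def)
  moreover have "card F' + (p - r) + (N - r - q) + r \<le> d"
  proof -
    have r_le: "r + card F' \<le> d" using * unfolding r_def by linarith
    have "r = d - card F' \<or> r = j \<or> r = N - j" unfolding r_def min_def by auto
    then consider "r = d - card F'" | "r = j" | "r = N - j" by blast
    then show ?thesis
    proof cases
      case 1
      then have "p \<le> r" "N - q \<le> r" using * ** by linarith+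
      then show ?thesis using r_le by simp
    next
      case 2
      then have "p \<le> r" using p by simp
      then show ?thesis using r_le ** by simp
    next
      case 3
      then have "N - r - q = 0" using q by simp
      then show ?thesis using r_le * by simp
    qed
  qed
  ultimately show thesis
    by (intro that[of r]) linarith+
qed

section \<open>The closure theorem\<close>

text \<open>The element t_(s-d) and the \<open>d\<close> elements of \<open>E\<close> beyond it give
  d + 1 zero layers above any point of smaller weight; t_(d+1) and its \<open>d\<close> predecessors
  do the same from below.\<close>

lemma polyfun_eq_0_on_L_op:
  assumes f: "polyfun n d f" and E: "E \<subseteq> {0..grid_N n k}"
    and zero: "\<And>x. x \<in> layers n k E \<Longrightarrow> f (\<lambda>i. real (x i)) = 0"
    and x: "x \<in> layers n k (L_op (grid_N n k) d E)"
  shows "f (\<lambda>i. real (x i)) = 0"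
proof (cases "wt n x \<in> E")
  case True
  with x zero show ?thesis by (auto simp: layers_def)
next
  case False
  have fin: "finite E" using E by (rule finite_subset) auto
  have xg: "x \<in> grid n k" using x by (simp add: layers_def)
  define u where "u = nth_elem E (card E - d)"
  define v where "v = nth_elem E (d + 1)"
  have big: "d < card E" and uv: "wt n x \<le> u \<or> v \<le> wt n x"
    using x False by (auto simp: layers_def L_op_def u_def v_def split: if_splits)
  have u: "u \<in> E" "card {t\<in>E. u < t} = d"
    using fin big nth_elem_props[of E "card E - d"] by (auto simp: u_def)
  have v: "v \<in> E" "card {t\<in>E. t < v} = d"
    using fin big nth_elem_props[of E "d + 1"] by (auto simp: v_def)
  have zero': "f (\<lambda>i. real (y i)) = 0" if "y \<in> layers n k T" "T \<subseteq> E" for y T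
    using that by (intro zero) (auto simp: layers_def)
  have "wt n x \<noteq> u" "wt n x \<noteq> v" using False u(1) v(1) by auto
  then consider "wt n x < u" | "v < wt n x" using uv by linarith
  then show ?thesis
  proof cases
    case 1
    let ?T = "insert u {t\<in>E. u < t}"
    show ?thesis
    proof (rule polyfun_eq_0_if_zeros_above[OF f xg])
      show "d < card ?T" using u fin by simp
      show "?T \<subseteq> {wt n x<..grid_N n k}" using 1 u E by auto
    qed (rule zero', use u in auto)
  next
    case 2
    let ?T = "insert v {t\<in>E. t < v}"
    show ?thesis
    proof (rule polyfun_eq_0_if_zeros_below[OF f xg])
      show "d < card ?T" using v fin by simp
      show "?T \<subseteq> {..<wt n x}" using 2 by auto
    qed (rule zero', use v in auto)
  qed
qed

lemma polyfun_eq_0_on_L_bar: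
  assumes f: "polyfun n d f" and E: "E \<subseteq> {0..grid_N n k}"
    and zero: "\<And>x. x \<in> layers n k E \<Longrightarrow> f (\<lambda>i. real (x i)) = 0"
    and x: "x \<in> layers n k (L_bar (grid_N n k) d E)"
  shows "f (\<lambda>i. real (x i)) = 0"
proof -
  have "\<forall>x\<in>layers n k ((L_op (grid_N n k) d ^^ i) E). f (\<lambda>i. real (x i)) = 0" for i
  proof (induction i)
    case (Suc i)
    show ?case
    proof
      fix x assume "x \<in> layers n k ((L_op (grid_N n k) d ^^ Suc i) E)"
      then have x: "x \<in> layers n k (L_op (grid_N n k) d ((L_op (grid_N n k) d ^^ i) E))" by simp
      show "f (\<lambda>i. real (x i)) = 0"
        by (rule polyfun_eq_0_on_L_op[OF f L_op_funpow_subset[OF E] _ x]) (rule bspec[OF Suc])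
    qed
  qed (use zero in auto)
  with x show ?thesis by (auto simp: layers_def L_bar_def)
qed

text \<open>The degree bound \<open>d\<close> is split: \<open>r\<close> for killing the outer
  layers, and one linear factor for each remaining layer of \<open>F\<close>. These factors are
  nonzero on layer \<open>j\<close> since \<open>j\<close> is not in \<open>F\<close>.\<close>

lemma exists_polyfun_nonzero_off_closed:
  assumes su: "strictly_unimodal n k"
    and F: "F \<subseteq> {0..grid_N n k}" "L_op (grid_N n k) d F = F"
    and j: "j \<le> grid_N n k" "j \<notin> F"
  shows "\<exists>f. polyfun n d f \<and> (\<forall>x\<in>layers n k F. f (\<lambda>i. real (x i)) = 0) \<and>
    (\<exists>x\<in>layers n k {j}. f (\<lambda>i. real (x i)) \<noteq> 0)"
proof -
  obtain r where r: "r \<le> j" "r + j \<le> grid_N n k" "r + card (F \<inter> {r..grid_N n k - r}) \<le> d"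
    using closed_set_radius[OF F j] .
  obtain h where h: "polyfun n r h"
    "\<And>x. x \<in> grid n k \<Longrightarrow> wt n x \<notin> {r..grid_N n k - r} \<Longrightarrow> h (\<lambda>i. real (x i)) = 0"
    "\<exists>x\<in>layers n k {j}. h (\<lambda>i. real (x i)) \<noteq> 0"
    using exists_central_polyfun[OF su r(1,2)] by blast
  define T where "T = F \<inter> {r..grid_N n k - r}"
  define f where "f = (\<lambda>x. h x * (\<Prod>t\<in>T. (\<Sum>i\<in>{1..n}. x i) - real t))"
  have fin: "finite T" by (simp add: T_def)
  have f_eq: "f (\<lambda>i. real (x i)) = h (\<lambda>i. real (x i)) * (\<Prod>t\<in>T. real (wt n x) - real t)" for x
    by (simp add: f_def wt_def)
  show ?thesis
  proof (intro exI[of _ f] conjI ballI)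
    show "polyfun n d f"
      unfolding f_def
      by (rule polyfun_mono[OF polyfun_mult[OF h(1) polyfun_layer_prod]]) (use r(3) in \<open>simp add: T_def\<close>)
  next
    fix x assume x: "x \<in> layers n k F"
    show "f (\<lambda>i. real (x i)) = 0"
    proof (cases "wt n x \<in> T")
      case True
      then have "(\<Prod>t\<in>T. real (wt n x) - real t) = 0" using fin by (intro prod_zero) auto
      then show ?thesis by (simp only: f_eq mult_zero_right)
    next
      case False
      then have "h (\<lambda>i. real (x i)) = 0" using x by (intro h(2)) (auto simp: layers_def T_def)
      then show ?thesis by (simp only: f_eq mult_zero_left)
    qed
  next
    obtain x where x: "x \<in> layers n k {j}" "h (\<lambda>i. real (x i)) \<noteq> 0" using h(3) by blast
    then have "wt n x \<notin> T" using j(2) by (simp add: layers_def T_def)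
    then have "(\<Prod>t\<in>T. real (wt n x) - real t) \<noteq> 0" using fin by auto
    with x show "\<exists>x\<in>layers n k {j}. f (\<lambda>i. real (x i)) \<noteq> 0" by (intro bexI[of _ x]) (simp only: f_eq mult_eq_0_iff, simp)
  qed
qed

theorem theorem1p7:
  fixes n :: nat and k :: "nat \<Rightarrow> nat" and d :: nat and E :: "nat set"
  assumes "uniform_grid n k"
    and "strictly_unimodal n k"
    and "d \<in> {0..grid_N n k}"
    and "E \<subseteq> {0..grid_N n k}"
  shows "Zstar_cl n k d E = L_bar (grid_N n k) d E"
proof (rule subset_antisym)
  show "L_bar (grid_N n k) d E \<subseteq> Zstar_cl n k d E"
  proof
    fix j assume j: "j \<in> L_bar (grid_N n k) d E"
    have "mpoly_eval P (\<lambda>i. real (a i)) = 0"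
      if "a \<in> layers n k {j}" "P \<in> mpolys n" "total_degree P \<le> d"
        "\<forall>x\<in>layers n k E. mpoly_eval P (\<lambda>i. real (x i)) = 0" for a P
    proof -
      have "polyfun n d (mpoly_eval P)"
        using that by (intro polyfun_mpoly_eval) (simp add: bounded_mpoly_def)
      then show ?thesis
        by (rule polyfun_eq_0_on_L_bar[OF _ assms(4)]) (use that j in \<open>auto simp: layers_def\<close>)
    qed
    then show "j \<in> Zstar_cl n k d E"
      using subsetD[OF L_bar_subset[OF assms(4)] j] by (auto simp: Zstar_cl_def Zcl_def layers_def)
  qed
  show "Zstar_cl n k d E \<subseteq> L_bar (grid_N n k) d E"
  proof (rule subsetI, rule ccontr)
    fix j assume j: "j \<in> Zstar_cl n k d E" "j \<notin> L_bar (grid_N n k) d E"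
    then have "j \<le> grid_N n k" by (simp add: Zstar_cl_def)
    then obtain f where f: "polyfun n d f"
      "\<And>x. x \<in> layers n k (L_bar (grid_N n k) d E) \<Longrightarrow> f (\<lambda>i. real (x i)) = 0"
      "\<exists>x\<in>layers n k {j}. f (\<lambda>i. real (x i)) \<noteq> 0"
      using exists_polyfun_nonzero_off_closed[OF assms(2) L_bar_subset[OF assms(4)]
          L_op_L_bar[OF assms(4)] _ j(2)] by blast
    obtain P where P: "bounded_mpoly n d P" "mpoly_eval P = f"
      using polyfun_imp_mpoly_eval[OF f(1)] by blast
    \<comment> \<open>Vanishing on the closed set includes vanishing on \<open>E\<close>, so
      \<open>P\<close> is an admissible test polynomial for \<open>Zcl\<close>.\<close>
    have "f (\<lambda>i. real (x i)) = 0" if "x \<in> layers n k E" for x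
      using that L_bar_superset by (intro f(2)) (auto simp: layers_def)
    with f(3) P j(1) show False
      by (auto simp: Zstar_cl_def Zcl_def bounded_mpoly_def)
  qed
qed

end
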